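(* For every $\alpha\in[1,2]$ and $\beta\in[\alpha-1,\alpha]$, the function $x\mapsto \frac{1}{E_{\alpha,\beta}(x)}$ is completely monotone on $(0,\infty)$.
   Context: For $\alpha>0$ and $\beta\in\mathbb{R}$, the two-parameter Mittag-Leffler function is the entire function $E_{\alpha,\beta}(z)=\sum_{k=0}^{\infty}\frac{z^k}{\Gamma(\alpha k+\beta)}$, $z\in\mathbb{C}$, with the convention $1/\Gamma(s)=0$ at the poles $s=0,-1,-2,\dots$ of $\Gamma$. A smooth function $f:(0,\infty)\to(0,\infty)$ is completely monotone (CM) if $(-1)^n f^{(n)}(x)\ge 0$ for all integers $n\ge 0$ and all $x>0$. *)

theory Defs
  imports "HOL-Analysis.Analysis"
begin

text \<open>\<^const>\<open>rGamma\<close> is \<open>1 / \<Gamma>\<close> with value 0 at the poles of \<open>\<Gamma>\<close>. The type of the argument is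
  polymorphic so that the same series gives the entire function on \<^typ>\<open>complex\<close> and its
  restriction to \<^typ>\<open>real\<close>; the two are identified in \<open>mittag_leffler_complex_of_real\<close>.\<close>

definition mittag_leffler :: "real \<Rightarrow> real \<Rightarrow> 'a \<Rightarrow> 'a::{real_normed_field,banach}" where
  "mittag_leffler \<alpha> \<beta> z = (\<Sum>k. of_real (rGamma (\<alpha> * real k + \<beta>)) * z ^ k)"

text \<open>The iterated derivatives at a point of the open half-line depend only on the values
  of \<open>f\<close> there, so the values of \<open>f\<close> at arguments \<open>\<le> 0\<close> are irrelevant.\<close>

definition completely_monotone :: "(real \<Rightarrow> real) \<Rightarrow> bool" where
  "completely_monotone f \<longleftrightarrow>
     (\<forall>x>0. f x > 0) \<and>
     (\<forall>n. \<forall>x>0. (deriv ^^ n) f differentiable (at x)) \<and>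
     (\<forall>n. \<forall>x>0. (-1) ^ n * (deriv ^^ n) f x \<ge> 0)"

lemma rGamma_real_le_powr:
  fixes y C :: real
  assumes y: "y \<ge> 2" and C: "C \<ge> 1"
  shows "rGamma y \<le> exp C * C powr (2 - y)"
proof -
  define n where "n = nat \<lfloor>y\<rfloor> - 1"
  have n: "1 + real n \<le> y" "y < 2 + real n" "n \<ge> 1"
    unfolding n_def using y by linarith+
  have "(\<lambda>k. C ^ k /\<^sub>R fact k) sums exp C"
    by (rule exp_converges)
  hence "sum (\<lambda>k. C ^ k /\<^sub>R fact k) {n} \<le> exp C"
    using C by (intro sum_le_suminf[THEN order_trans]) (auto simp: sums_iff)
  hence "C ^ n / fact n \<le> exp C"
    by (simp add: field_simps)
  hence fact_ge: "C ^ n \<le> exp C * fact n"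
    by (simp add: field_simps)
  have "fact n = Gamma (1 + real n)"
    by (simp add: Gamma_fact)
  also have "\<dots> \<le> Gamma y"
    using Gamma_real_strict_mono[of "1 + real n" y] n by (cases "1 + real n = y") auto
  finally have G: "fact n \<le> Gamma y" .
  have "C powr (y - 2) \<le> C powr real n"
    using n C by (intro powr_mono) auto
  also have "\<dots> = C ^ n"
    using C by (simp add: powr_realpow)
  also note fact_ge
  also have "exp C * fact n \<le> exp C * Gamma y"
    using G by simp
  finally have le: "C powr (y - 2) \<le> exp C * Gamma y" .
  define P where "P = C powr (y - 2)"
  have "P > 0" "Gamma y > 0"
    using C y by (auto simp: P_def)
  moreover have "P \<le> exp C * Gamma y"
    using le by (simp add: P_def)
  ultimately have "rGamma y \<le> exp C * inverse P"
    by (simp add: rGamma_inverse_Gamma field_simps)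
  also have "inverse P = C powr (2 - y)"
    by (simp add: P_def flip: powr_minus)
  finally show ?thesis .
qed

lemma summable_mittag_leffler:
  fixes z :: "'a::{real_normed_field,banach}"
  assumes "\<alpha> > 0"
  shows "summable (\<lambda>k. of_real (rGamma (\<alpha> * real k + \<beta>)) * z ^ k)"
proof -
  define C where "C = (2 * norm z + 1) powr (1 / \<alpha>)"
  have C: "C \<ge> 1"
    unfolding C_def using assms by (intro ge_one_powr_ge_zero) auto
  define q where "q = norm z / (2 * norm z + 1)"
  have q: "0 \<le> q" "q < 1"
    unfolding q_def by (auto simp: divide_simps add_nonneg_pos)
  have C_powr: "C powr (- \<alpha> * real k) = 1 / (2 * norm z + 1) ^ k" for k
  proof -
    have "C powr (- \<alpha> * real k) = (2 * norm z + 1) powr (- real k)"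
      using assms by (simp add: C_def powr_powr)
    also have "\<dots> = 1 / (2 * norm z + 1) ^ k"
      by (simp add: powr_minus powr_realpow add_nonneg_pos divide_inverse)
    finally show ?thesis .
  qed
  have "eventually (\<lambda>k. real k \<ge> (2 - \<beta>) / \<alpha>) sequentially"
    by (rule eventually_compose_filterlim[OF eventually_ge_at_top filterlim_real_sequentially])
  hence "eventually (\<lambda>k. norm (of_real (rGamma (\<alpha> * real k + \<beta>)) * z ^ k) \<le>
           exp C * C powr (2 - \<beta>) * q ^ k) sequentially"
  proof eventually_elim
    case (elim k)
    hence y: "\<alpha> * real k + \<beta> \<ge> 2"
      using assms by (simp add: field_simps)
    hence r: "rGamma (\<alpha> * real k + \<beta>) \<ge> 0"
      by (simp add: rGamma_inverse_Gamma less_imp_le)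
    have "norm (of_real (rGamma (\<alpha> * real k + \<beta>)) * z ^ k) = rGamma (\<alpha> * real k + \<beta>) * norm z ^ k"
      using r by (simp add: norm_mult norm_power)
    also have "\<dots> \<le> exp C * C powr (2 - (\<alpha> * real k + \<beta>)) * norm z ^ k"
      by (intro mult_right_mono rGamma_real_le_powr y C) auto
    also have "C powr (2 - (\<alpha> * real k + \<beta>)) = C powr (2 - \<beta>) * C powr (- \<alpha> * real k)"
      by (simp flip: powr_add add: algebra_simps)
    also have "\<dots> = C powr (2 - \<beta>) * (1 / (2 * norm z + 1) ^ k)"
      by (simp only: C_powr)
    finally show ?case
      by (simp add: q_def power_divide)
  qed
  moreover have "summable (\<lambda>k. exp C * C powr (2 - \<beta>) * q ^ k)"
    using q by (intro summable_mult summable_geometric) auto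
  ultimately show ?thesis
    by (rule summable_comparison_test_ev)
qed

lemma mittag_leffler_complex_of_real:
  assumes "\<alpha> > 0"
  shows "mittag_leffler \<alpha> \<beta> (complex_of_real x) = complex_of_real (mittag_leffler \<alpha> \<beta> x)"
  using suminf_of_real[OF summable_mittag_leffler[OF assms, of \<beta> x], where ?'a = complex]
  by (simp add: mittag_leffler_def)

end

theory Submission
  imports Defs "HOL-Real_Asymp.Real_Asymp"
begin

text \<open>With \<open>x = q h\<^sup>\<alpha>\<close>, the Gruenwald--Letnikov discretisation of the fractional equation
  \<open>D\<^sup>\<alpha> f = q f\<close>, which is solved by \<open>f(t) = t\<^sup>\<beta>\<^sup>-\<^sup>1 E\<^bsub>\<alpha>,\<beta>\<^esub>(q t\<^sup>\<alpha>)\<close>, gives polynomials \<open>p\<^sub>n(x)\<close> with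
  generating function \<open>(1 - z)\<^bsup>\<alpha>-\<beta>\<^esup> / ((1 - z)\<^sup>\<alpha> - x z)\<close>. In the recursion
  \<open>p\<^bsub>n+1\<^esub> = (\<alpha> + x) p\<^sub>n - (\<Sum>j. w\<^sub>j p\<^sub>j)\<close> all weights \<open>w\<^sub>j\<close> are nonnegative precisely because
  \<open>\<alpha> \<in> [1,2]\<close> and \<open>\<alpha> - \<beta> \<in> [0,1]\<close>. Hence, by induction, \<open>p\<^bsub>n+1\<^esub> / p\<^sub>n\<close> is a positive
  function with completely monotone derivative, its reciprocal is completely monotone, and so
  is the product \<open>1 / p\<^sub>n\<close> of these reciprocals. Rescaling \<open>p\<^sub>n\<close> and letting \<open>n \<rightarrow> \<infinity>\<close> gives \<open>E\<^bsub>\<alpha>,\<beta>\<^esub>\<close>.\<close>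

section \<open>Complete monotonicity up to a finite order\<close>

text \<open>Complete monotonicity up to order \<open>n\<close>. The witness \<open>f'\<close> stands
  for minus the derivative, so no signs occur and closure proofs are inductions that name the next
  witness. Nonnegativity instead of positivity allows zero weights and pointwise limits.\<close>

primrec cm_upto :: "nat \<Rightarrow> (real \<Rightarrow> real) \<Rightarrow> bool" where
  "cm_upto 0 f \<longleftrightarrow> (\<forall>x>0. f x \<ge> 0)"
| "cm_upto (Suc n) f \<longleftrightarrow> (\<forall>x>0. f x \<ge> 0) \<and>
     (\<exists>f'. (\<forall>x>0. (f has_real_derivative - f' x) (at x)) \<and> cm_upto n f')"

lemma cm_upto_nonneg: "cm_upto n f \<Longrightarrow> x > 0 \<Longrightarrow> f x \<ge> 0"
  by (cases n) auto

lemma has_real_derivative_cong_pos: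
  fixes f g :: "real \<Rightarrow> real"
  assumes "x > 0" "\<And>y. y > 0 \<Longrightarrow> f y = g y"
  shows "(f has_real_derivative D) (at x) \<longleftrightarrow> (g has_real_derivative D) (at x)"
proof -
  have "eventually (\<lambda>y. y \<in> {0<..}) (nhds x)"
    using assms(1) by (intro eventually_nhds_in_open) auto
  hence "eventually (\<lambda>y. f y = g y) (nhds x)"
    by eventually_elim (use assms(2) in auto)
  thus ?thesis
    by (intro DERIV_cong_ev) auto
qed

lemma cm_upto_cong:
  assumes "\<And>x. x > 0 \<Longrightarrow> f x = g x"
  shows "cm_upto n f \<longleftrightarrow> cm_upto n g"
  using assms has_real_derivative_cong_pos[OF _ assms]
  by (cases n) (auto cong: conj_cong)

lemma cm_upto_Suc: "cm_upto (Suc n) f \<Longrightarrow> cm_upto n f"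
proof (induction n arbitrary: f)
  case (Suc n)
  from Suc.prems obtain f' where
    "\<forall>x>0. f x \<ge> 0" "\<forall>x>0. (f has_real_derivative - f' x) (at x)" "cm_upto (Suc n) f'"
    by auto
  thus ?case
    using Suc.IH[of f'] by auto
qed auto

lemma cm_upto_const: "a \<ge> 0 \<Longrightarrow> cm_upto n (\<lambda>_. a)"
proof (induction n arbitrary: a)
  case (Suc n)
  have "cm_upto n (\<lambda>_. 0)"
    by (rule Suc.IH) simp
  thus ?case
    using Suc.prems by (auto intro!: exI[of _ "\<lambda>_. 0"])
qed auto

section \<open>Closure under sums, products and positive scaling\<close>

lemma cm_upto_add: "cm_upto n f \<Longrightarrow> cm_upto n g \<Longrightarrow> cm_upto n (\<lambda>x. f x + g x)"
proof (induction n arbitrary: f g)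
  case (Suc n)
  from Suc.prems obtain f' g' where
    "\<forall>x>0. (f has_real_derivative - f' x) (at x)" "cm_upto n f'"
    "\<forall>x>0. (g has_real_derivative - g' x) (at x)" "cm_upto n g'"
    by auto
  with Suc show ?case
    by (auto intro!: exI[of _ "\<lambda>x. f' x + g' x"] derivative_eq_intros)
qed auto

lemma cm_upto_mult: "cm_upto n f \<Longrightarrow> cm_upto n g \<Longrightarrow> cm_upto n (\<lambda>x. f x * g x)"
proof (induction n arbitrary: f g)
  case (Suc n)
  from Suc.prems obtain f' g' where
    "\<forall>x>0. (f has_real_derivative - f' x) (at x)" "cm_upto n f'"
    "\<forall>x>0. (g has_real_derivative - g' x) (at x)" "cm_upto n g'"
    by auto
  moreover have "cm_upto n (\<lambda>x. f' x * g x + g' x * f x)"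
    using calculation by (intro cm_upto_add Suc.IH Suc.prems[THEN cm_upto_Suc]) auto
  ultimately show ?case
    using Suc.prems
    by (auto intro!: exI[of _ "\<lambda>x. f' x * g x + g' x * f x"] derivative_eq_intros)
qed auto

lemma cm_upto_sum: "(\<And>i. i \<in> I \<Longrightarrow> cm_upto n (f i)) \<Longrightarrow> cm_upto n (\<lambda>x. \<Sum>i\<in>I. f i x)"
  by (induction I rule: infinite_finite_induct) (auto intro: cm_upto_const cm_upto_add)

lemma cm_upto_scale:
  assumes "c > 0"
  shows "cm_upto n f \<Longrightarrow> cm_upto n (\<lambda>x. f (c * x))"
proof (induction n arbitrary: f)
  case (Suc n)
  from Suc.prems obtain f' where
    f': "\<And>x. x > 0 \<Longrightarrow> (f has_real_derivative - f' x) (at x)" "cm_upto n f'"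
    by auto
  have "((\<lambda>x. f (c * x)) has_real_derivative - (c * f' (c * x))) (at x)" if "x > 0" for x
  proof -
    have "((\<lambda>x. f (c * x)) has_real_derivative - f' (c * x) * c) (at x)"
      using that assms by (intro DERIV_chain2[OF f'(1)] DERIV_cmult_Id) auto
    thus ?thesis
      by (simp add: mult.commute)
  qed
  moreover have "cm_upto n (\<lambda>x. c * f' (c * x))"
    using assms f' by (intro cm_upto_mult cm_upto_const Suc.IH) auto
  ultimately show ?case
    using Suc.prems assms by (auto intro!: exI[of _ "\<lambda>x. c * f' (c * x)"])
qed (use assms in auto)

text \<open>A positive function with completely monotone derivative has a completely monotone
  reciprocal. With \<open>S'\<close> for minus the derivative of \<open>S\<close>, the reciprocal
  \<open>h\<close> satisfies -h' = h (1 + \<open>S'\<close>) h, so each order of \<open>h\<close>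
  follows from the preceding order of \<open>h\<close> and of \<open>S'\<close>.\<close>

lemma cm_upto_inverse_minus:
  assumes "cm_upto n S" and pos: "\<And>x. x > 0 \<Longrightarrow> a + x - S x > 0"
  shows "cm_upto n (\<lambda>x. inverse (a + x - S x))"
  using assms(1)
proof (induction n)
  case 0
  thus ?case using pos by (auto simp: less_imp_le)
next
  case (Suc n)
  from Suc.prems obtain S' where
    S': "\<And>x. x > 0 \<Longrightarrow> (S has_real_derivative - S' x) (at x)" "cm_upto n S'"
    by auto
  define h where "h = (\<lambda>x. inverse (a + x - S x))"
  have "cm_upto n h"
    unfolding h_def by (intro Suc.IH Suc.prems[THEN cm_upto_Suc])
  hence cm: "cm_upto n (\<lambda>x. h x * (1 + S' x) * h x)"
    using S' by (intro cm_upto_mult cm_upto_add cm_upto_const) auto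
  have deriv: "(h has_real_derivative - (h x * (1 + S' x) * h x)) (at x)" if "x > 0" for x
  proof -
    have "((\<lambda>x. a + x - S x) has_real_derivative 1 + S' x) (at x)"
      using that by (auto intro!: derivative_eq_intros S'(1))
    thus ?thesis
      unfolding h_def using pos[OF that] by (intro DERIV_inverse') auto
  qed
  have nonneg: "h x \<ge> 0" if "x > 0" for x
    using pos[OF that] by (simp add: h_def)
  have "cm_upto (Suc n) h"
    unfolding cm_upto.simps
    by (intro conjI allI impI exI[of _ "\<lambda>x. h x * (1 + S' x) * h x"] cm deriv nonneg)
  thus ?case
    by (simp add: h_def)
qed

text \<open>Of the order \<open>n + m\<close>, differentiating \<open>n\<close> times consumes
  \<open>n\<close>; the rest stays with \<open>h\<close>, which is what the induction needs for one
  more derivative.\<close>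

lemma cm_upto_iterated_deriv:
  "cm_upto (n + m) f \<Longrightarrow> \<exists>h. cm_upto m h \<and> (\<forall>x>0. (deriv ^^ n) f x = (-1) ^ n * h x)"
proof (induction n arbitrary: m)
  case (Suc n)
  then obtain h where h: "cm_upto (Suc m) h" "\<And>x. x > 0 \<Longrightarrow> (deriv ^^ n) f x = (-1) ^ n * h x"
    using Suc.IH[of "Suc m"] by auto
  from h(1) obtain h' where
    h': "\<And>x. x > 0 \<Longrightarrow> (h has_real_derivative - h' x) (at x)" "cm_upto m h'"
    by auto
  have "deriv ((deriv ^^ n) f) x = (-1) ^ Suc n * h' x" if "x > 0" for x
  proof (rule DERIV_imp_deriv)
    have "((\<lambda>x. (-1) ^ n * h x) has_real_derivative (-1) ^ Suc n * h' x) (at x)"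
      using that by (auto intro!: derivative_eq_intros h')
    thus "((deriv ^^ n) f has_real_derivative (-1) ^ Suc n * h' x) (at x)"
      by (subst has_real_derivative_cong_pos[OF that h(2)])
  qed
  thus ?case
    using h' by auto
qed auto

lemma completely_monotoneI:
  assumes pos: "\<And>x. x > 0 \<Longrightarrow> f x > 0" and cm: "\<And>n. cm_upto n f"
  shows "completely_monotone f"
  unfolding completely_monotone_def
proof (intro conjI allI impI)
  fix n and x :: real
  assume x: "x > 0"
  \<comment> \<open>The one extra order provides differentiability of the \<open>n\<close>-th
    derivative.\<close>
  from cm_upto_iterated_deriv[OF cm[of "n + 1"]] obtain h where
    h: "cm_upto 1 h" "\<And>x. x > 0 \<Longrightarrow> (deriv ^^ n) f x = (-1) ^ n * h x"
    by auto
  from h(1) obtain h' where h': "\<And>x. x > 0 \<Longrightarrow> (h has_real_derivative - h' x) (at x)"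
    by auto
  have "((\<lambda>x. (-1) ^ n * h x) has_real_derivative (-1) ^ n * - h' x) (at x)"
    using x by (auto intro!: derivative_eq_intros h')
  hence "((deriv ^^ n) f has_real_derivative (-1) ^ n * - h' x) (at x)"
    by (subst has_real_derivative_cong_pos[OF x h(2)])
  thus "(deriv ^^ n) f differentiable (at x)"
    by (auto simp: real_differentiable_def)
  have "(-1) ^ n * (deriv ^^ n) f x = ((-1) ^ n * (-1) ^ n) * h x"
    using h(2)[OF x] by simp
  also have "\<dots> = h x"
    by (simp flip: power_mult_distrib)
  finally show "(-1) ^ n * (deriv ^^ n) f x \<ge> 0"
    using cm_upto_nonneg[OF h(1) x] by simp
qed (use pos in auto)

section \<open>Pointwise convergence together with derivatives\<close>

text \<open>Only pointwise convergence is asked of each derivative. No uniformity is required,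
  because differentiability of the limit and the identity of its derivatives are part of the
  notion.\<close>

primrec C_tendsto :: "nat \<Rightarrow> (nat \<Rightarrow> real \<Rightarrow> real) \<Rightarrow> (real \<Rightarrow> real) \<Rightarrow> bool" where
  "C_tendsto 0 F f \<longleftrightarrow> (\<forall>x>0. (\<lambda>n. F n x) \<longlonglongrightarrow> f x)"
| "C_tendsto (Suc m) F f \<longleftrightarrow> (\<forall>x>0. (\<lambda>n. F n x) \<longlonglongrightarrow> f x) \<and>
     (\<exists>F' f'. (\<forall>n. \<forall>x>0. (F n has_real_derivative F' n x) (at x)) \<and>
              (\<forall>x>0. (f has_real_derivative f' x) (at x)) \<and> C_tendsto m F' f')"

lemma C_tendsto_pointwise: "C_tendsto m F f \<Longrightarrow> x > 0 \<Longrightarrow> (\<lambda>n. F n x) \<longlonglongrightarrow> f x"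
  by (cases m) auto

lemma C_tendsto_SucE:
  assumes "C_tendsto (Suc m) F f"
  obtains F' f' where "\<And>x. x > 0 \<Longrightarrow> (\<lambda>n. F n x) \<longlonglongrightarrow> f x"
    "\<And>n x. x > 0 \<Longrightarrow> (F n has_real_derivative F' n x) (at x)"
    "\<And>x. x > 0 \<Longrightarrow> (f has_real_derivative f' x) (at x)" "C_tendsto m F' f'"
  using assms unfolding C_tendsto.simps by blast

lemma C_tendsto_SucI:
  assumes "\<And>x. x > 0 \<Longrightarrow> (\<lambda>n. F n x) \<longlonglongrightarrow> f x"
    "\<And>n x. x > 0 \<Longrightarrow> (F n has_real_derivative F' n x) (at x)"
    "\<And>x. x > 0 \<Longrightarrow> (f has_real_derivative f' x) (at x)" "C_tendsto m F' f'"
  shows "C_tendsto (Suc m) F f"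
  using assms unfolding C_tendsto.simps by blast

lemma C_tendsto_Suc: "C_tendsto (Suc m) F f \<Longrightarrow> C_tendsto m F f"
proof (induction m arbitrary: F f)
  case (Suc m)
  from Suc.prems show ?case
    by (rule C_tendsto_SucE) (rule C_tendsto_SucI, auto intro: Suc.IH simp del: C_tendsto.simps)
qed auto

section \<open>Closure under negation, sums, products and reciprocals\<close>

lemma C_tendsto_uminus: "C_tendsto m F f \<Longrightarrow> C_tendsto m (\<lambda>n x. - F n x) (\<lambda>x. - f x)"
proof (induction m arbitrary: F f)
  case (Suc m)
  obtain F' f' where F: "\<And>x. x > 0 \<Longrightarrow> (\<lambda>n. F n x) \<longlonglongrightarrow> f x"
    "\<And>n x. x > 0 \<Longrightarrow> (F n has_real_derivative F' n x) (at x)"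
    "\<And>x. x > 0 \<Longrightarrow> (f has_real_derivative f' x) (at x)" "C_tendsto m F' f'"
    using Suc.prems by (rule C_tendsto_SucE) blast
  have "C_tendsto m (\<lambda>n x. - F' n x) (\<lambda>x. - f' x)"
    by (intro Suc.IH F)
  thus ?case
  proof (rule C_tendsto_SucI[rotated 3])
    show "(\<lambda>n. - F n x) \<longlonglongrightarrow> - f x" if "x > 0" for x
      using that by (intro tendsto_minus F)
    show "((\<lambda>x. - F n x) has_real_derivative - F' n x) (at x)" if "x > 0" for n x
      using that by (intro DERIV_minus F)
    show "((\<lambda>x. - f x) has_real_derivative - f' x) (at x)" if "x > 0" for x
      using that by (intro DERIV_minus F)
  qed
qed (auto intro: tendsto_minus)

lemma C_tendsto_add:
  "C_tendsto m F f \<Longrightarrow> C_tendsto m G g \<Longrightarrow> C_tendsto m (\<lambda>n x. F n x + G n x) (\<lambda>x. f x + g x)"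
proof (induction m arbitrary: F f G g)
  case (Suc m)
  obtain F' f' where F: "\<And>x. x > 0 \<Longrightarrow> (\<lambda>n. F n x) \<longlonglongrightarrow> f x"
    "\<And>n x. x > 0 \<Longrightarrow> (F n has_real_derivative F' n x) (at x)"
    "\<And>x. x > 0 \<Longrightarrow> (f has_real_derivative f' x) (at x)" "C_tendsto m F' f'"
    using Suc.prems(1) by (rule C_tendsto_SucE) blast
  obtain G' g' where G: "\<And>x. x > 0 \<Longrightarrow> (\<lambda>n. G n x) \<longlonglongrightarrow> g x"
    "\<And>n x. x > 0 \<Longrightarrow> (G n has_real_derivative G' n x) (at x)"
    "\<And>x. x > 0 \<Longrightarrow> (g has_real_derivative g' x) (at x)" "C_tendsto m G' g'"
    using Suc.prems(2) by (rule C_tendsto_SucE) blast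
  have "C_tendsto m (\<lambda>n x. F' n x + G' n x) (\<lambda>x. f' x + g' x)"
    by (intro Suc.IH F G)
  thus ?case
  proof (rule C_tendsto_SucI[rotated 3])
    show "(\<lambda>n. F n x + G n x) \<longlonglongrightarrow> f x + g x" if "x > 0" for x
      using that by (intro tendsto_add F G)
    show "((\<lambda>x. F n x + G n x) has_real_derivative F' n x + G' n x) (at x)" if "x > 0" for n x
      using that by (intro DERIV_add F G)
    show "((\<lambda>x. f x + g x) has_real_derivative f' x + g' x) (at x)" if "x > 0" for x
      using that by (intro DERIV_add F G)
  qed
qed (auto intro: tendsto_add)

lemma C_tendsto_mult:
  "C_tendsto m F f \<Longrightarrow> C_tendsto m G g \<Longrightarrow> C_tendsto m (\<lambda>n x. F n x * G n x) (\<lambda>x. f x * g x)"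
proof (induction m arbitrary: F f G g)
  case (Suc m)
  obtain F' f' where F: "\<And>x. x > 0 \<Longrightarrow> (\<lambda>n. F n x) \<longlonglongrightarrow> f x"
    "\<And>n x. x > 0 \<Longrightarrow> (F n has_real_derivative F' n x) (at x)"
    "\<And>x. x > 0 \<Longrightarrow> (f has_real_derivative f' x) (at x)" "C_tendsto m F' f'"
    using Suc.prems(1) by (rule C_tendsto_SucE) blast
  obtain G' g' where G: "\<And>x. x > 0 \<Longrightarrow> (\<lambda>n. G n x) \<longlonglongrightarrow> g x"
    "\<And>n x. x > 0 \<Longrightarrow> (G n has_real_derivative G' n x) (at x)"
    "\<And>x. x > 0 \<Longrightarrow> (g has_real_derivative g' x) (at x)" "C_tendsto m G' g'"
    using Suc.prems(2) by (rule C_tendsto_SucE) blast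
  have "C_tendsto m (\<lambda>n x. F' n x * G n x + G' n x * F n x) (\<lambda>x. f' x * g x + g' x * f x)"
    by (intro C_tendsto_add Suc.IH F G Suc.prems[THEN C_tendsto_Suc])
  thus ?case
  proof (rule C_tendsto_SucI[rotated 3])
    show "(\<lambda>n. F n x * G n x) \<longlonglongrightarrow> f x * g x" if "x > 0" for x
      using that by (intro tendsto_mult F G)
    show "((\<lambda>x. F n x * G n x) has_real_derivative F' n x * G n x + G' n x * F n x) (at x)" if "x > 0" for n x
      using that by (intro DERIV_mult F G)
    show "((\<lambda>x. f x * g x) has_real_derivative f' x * g x + g' x * f x) (at x)" if "x > 0" for x
      using that by (intro DERIV_mult F G)
  qed
qed (auto intro: tendsto_mult)

lemma C_tendsto_inverse:
  assumes "C_tendsto m F f" and nz: "\<And>n x. x > 0 \<Longrightarrow> F n x \<noteq> 0" "\<And>x. x > 0 \<Longrightarrow> f x \<noteq> 0"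
  shows "C_tendsto m (\<lambda>n x. inverse (F n x)) (\<lambda>x. inverse (f x))"
  using assms(1)
proof (induction m)
  case 0
  thus ?case using nz by (auto intro: tendsto_inverse)
next
  case (Suc m)
  obtain F' f' where F: "\<And>x. x > 0 \<Longrightarrow> (\<lambda>n. F n x) \<longlonglongrightarrow> f x"
    "\<And>n x. x > 0 \<Longrightarrow> (F n has_real_derivative F' n x) (at x)"
    "\<And>x. x > 0 \<Longrightarrow> (f has_real_derivative f' x) (at x)" "C_tendsto m F' f'"
    using Suc.prems(1) by (rule C_tendsto_SucE) blast
  \<comment> \<open>The derivative of 1/F is written as a product containing 1/F twice, so that the
    induction hypothesis for the reciprocals themselves and the product rule apply.\<close>
  have "C_tendsto m (\<lambda>n x. - (inverse (F n x) * F' n x * inverse (F n x)))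
          (\<lambda>x. - (inverse (f x) * f' x * inverse (f x)))"
    by (intro C_tendsto_uminus C_tendsto_mult Suc.IH F Suc.prems[THEN C_tendsto_Suc])
  thus ?case
  proof (rule C_tendsto_SucI[rotated 3])
    show "(\<lambda>n. inverse (F n x)) \<longlonglongrightarrow> inverse (f x)" if "x > 0" for x
      using that by (intro tendsto_inverse F nz)
    show "((\<lambda>x. inverse (F n x)) has_real_derivative - (inverse (F n x) * F' n x * inverse (F n x))) (at x)" if "x > 0" for n x
      using that by (intro DERIV_inverse' F nz)
    show "((\<lambda>x. inverse (f x)) has_real_derivative - (inverse (f x) * f' x * inverse (f x))) (at x)" if "x > 0" for x
      using that by (intro DERIV_inverse' F nz)
  qed
qed

text \<open>Weak inequalities survive pointwise limits, and this applies to every derivative in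
  turn.\<close>

lemma cm_upto_C_tendsto:
  assumes "C_tendsto m F f" and "\<And>n. cm_upto m (F n)"
  shows "cm_upto m f"
  using assms
proof (induction m arbitrary: F f)
  case 0
  show ?case unfolding cm_upto.simps
  proof (intro allI impI)
    fix x :: real assume "x > 0"
    thus "f x \<ge> 0"
      using C_tendsto_pointwise[OF 0(1), of x] cm_upto_nonneg[OF 0(2), of x]
      by (intro LIMSEQ_le_const) auto
  qed
next
  case (Suc m)
  obtain F' f' where
    F': "\<And>n x. x > 0 \<Longrightarrow> (F n has_real_derivative F' n x) (at x)"
    "\<And>x. x > 0 \<Longrightarrow> (f has_real_derivative f' x) (at x)" "C_tendsto m F' f'"
    using Suc.prems(1) by (rule C_tendsto_SucE) blast
  have "f x \<ge> 0" if "x > 0" for x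
    using C_tendsto_pointwise[OF Suc.prems(1) that] cm_upto_nonneg[OF Suc.prems(2) that]
    by (intro LIMSEQ_le_const) auto
  moreover have F'_cm: "cm_upto m (\<lambda>x. - F' n x)" for n
  proof -
    from Suc.prems(2)[of n] obtain G where
      G: "\<forall>x>0. (F n has_real_derivative - G x) (at x)" "cm_upto m G"
      by auto
    \<comment> \<open>The derivative witnesses of \<open>C_tendsto\<close> and of
      \<open>cm_upto\<close> are chosen independently; uniqueness of derivatives identifies
      them.\<close>
    have "- F' n x = G x" if "x > 0" for x
      using DERIV_unique[OF F'(1)[OF that, of n] G(1)[rule_format, OF that]] by simp
    with G(2) show ?thesis
      using cm_upto_cong[of "\<lambda>x. - F' n x" G m] by simp
  qed
  moreover have "cm_upto m (\<lambda>x. - f' x)"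
    by (rule Suc.IH[OF C_tendsto_uminus[OF F'(3)] F'_cm])
  ultimately show ?case
    unfolding cm_upto.simps using F'(2) by (intro conjI exI[of _ "\<lambda>x. - f' x"]) simp_all
qed

text \<open>Dominated convergence for series (Tannery). The majorant is asked for only from
  \<open>k = 1\<close> on, since in the application the exponent at \<open>k = 0\<close> is \<beta>,
  which may lie below 1, outside the range of \<open>ml_coeff_le\<close>.\<close>

lemma tendsto_power_series:
  fixes a :: "nat \<Rightarrow> nat \<Rightarrow> real"
  assumes "\<And>y. summable (\<lambda>k. b k * y ^ k)"
    and "\<And>k. (\<lambda>n. a n k) \<longlonglongrightarrow> c k" and "\<And>n k. k \<ge> 1 \<Longrightarrow> \<bar>a n k\<bar> \<le> b k"
    and x: "x > 0"
  shows "(\<lambda>n. \<Sum>k. a n k * x ^ k) \<longlonglongrightarrow> (\<Sum>k. c k * x ^ k)"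
proof -
  have "norm (a n k * x ^ k) \<le> b k * x ^ k" if "k \<ge> 1" for n k
    using assms(3)[OF that] x by (auto simp: abs_mult intro!: mult_right_mono)
  hence "eventually (\<lambda>(k,n). norm (a n k * x ^ k) \<le> b k * x ^ k) (sequentially \<times>\<^sub>F sequentially)"
    unfolding eventually_prod_sequentially by (intro exI[of _ 1]) auto
  thus ?thesis
    using assms(1)[of x]
    by (intro tannerys_theorem[THEN conjunct2, THEN conjunct2] tendsto_mult tendsto_const assms(2)) auto
qed

text \<open>Termwise differentiation preserves all the hypotheses. Since \<open>diffs\<close> shifts
  the index up by one, the majorant of the derivatives is even valid at
  \<open>k = 0\<close>.\<close>

lemma C_tendsto_power_series:
  fixes a :: "nat \<Rightarrow> nat \<Rightarrow> real"
  assumes "\<And>n y. summable (\<lambda>k. a n k * y ^ k)" "\<And>y. summable (\<lambda>k. c k * y ^ k)"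
    and "\<And>y. summable (\<lambda>k. b k * y ^ k)"
    and "\<And>k. (\<lambda>n. a n k) \<longlonglongrightarrow> c k" and "\<And>n k. k \<ge> 1 \<Longrightarrow> \<bar>a n k\<bar> \<le> b k"
  shows "C_tendsto m (\<lambda>n x. \<Sum>k. a n k * x ^ k) (\<lambda>x. \<Sum>k. c k * x ^ k)"
  using assms
proof (induction m arbitrary: a b c)
  case (0 a b c)
  thus ?case
    using tendsto_power_series[of b a c] by auto
next
  case (Suc m a b c)
  have "C_tendsto m (\<lambda>n x. \<Sum>k. diffs (a n) k * x ^ k) (\<lambda>x. \<Sum>k. diffs c k * x ^ k)"
  proof (rule Suc.IH)
    show "(\<lambda>n. diffs (a n) k) \<longlonglongrightarrow> diffs c k" for k
      unfolding diffs_def by (intro tendsto_mult tendsto_const Suc.prems)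
    show "\<bar>diffs (a n) k\<bar> \<le> diffs b k" for n k
      using Suc.prems(5)[of "Suc k" n] by (auto simp: diffs_def abs_mult intro!: mult_left_mono)
  qed (intro termdiff_converges_all Suc.prems)+
  thus ?case
  proof (rule C_tendsto_SucI[rotated 3])
    show "(\<lambda>n. \<Sum>k. a n k * x ^ k) \<longlonglongrightarrow> (\<Sum>k. c k * x ^ k)" if "x > 0" for x
      using that by (intro tendsto_power_series[of b] Suc.prems)
  qed (intro termdiffs_strong_converges_everywhere Suc.prems)+
qed

section \<open>The approximating polynomials\<close>

text \<open>\<open>binom_coeff s m\<close> is the coefficient of \<open>z\<^sup>m\<close> in \<open>(1 - z) powr - s\<close>.\<close>

definition binom_coeff :: "real \<Rightarrow> nat \<Rightarrow> real" where
  "binom_coeff s m = pochhammer s m / fact m"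

lemma binom_coeff_0 [simp]: "binom_coeff s 0 = 1"
  by (simp add: binom_coeff_def)

lemma binom_coeff_1 [simp]: "binom_coeff s (Suc 0) = s"
  by (simp add: binom_coeff_def)

lemma binom_coeff_nonneg: "s \<ge> 0 \<Longrightarrow> binom_coeff s m \<ge> 0"
  by (simp add: binom_coeff_def pochhammer_prod prod_nonneg)

text \<open>Compares coefficients in (1 - z)^(-a) (1 - z)^(-b) = (1 - z)^(-(a + b)), that is,
  Vandermonde's identity for rising factorials.\<close>

lemma binom_coeff_convolution:
  "binom_coeff (a + b) n = (\<Sum>k\<le>n. binom_coeff a k * binom_coeff b (n - k))"
proof -
  have "binom_coeff (a + b) n =
          (\<Sum>k\<le>n. real (n choose k) * pochhammer a k * pochhammer b (n - k) / fact n)"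
    by (simp add: binom_coeff_def pochhammer_binomial_sum sum_divide_distrib)
  also have "\<dots> = (\<Sum>k\<le>n. binom_coeff a k * binom_coeff b (n - k))"
    by (intro sum.cong refl) (simp add: binom_coeff_def binomial_fact field_simps)
  finally show ?thesis .
qed

text \<open>Only the first factor of the rising factorial is nonpositive. It serves for
  \<open>s\<close> = \<beta> - \<alpha>.\<close>

lemma binom_coeff_nonpos:
  assumes "s \<in> {-1..0}" "m \<ge> 1"
  shows "binom_coeff s m \<le> 0"
proof -
  obtain k where m: "m = Suc k"
    using assms by (cases m) auto
  have "pochhammer s m = s * pochhammer (s + 1) k"
    by (simp add: m pochhammer_rec)
  also have "\<dots> \<le> 0"
    using assms by (intro mult_nonpos_nonneg) (auto simp: pochhammer_prod intro!: prod_nonneg)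
  finally show ?thesis
    by (simp add: binom_coeff_def divide_nonpos_pos)
qed

text \<open>Exactly the first two factors of the rising factorial are nonpositive. It serves for
  \<open>s\<close> = -\<alpha>, the weights of the recursion.\<close>

lemma binom_coeff_nonneg':
  assumes "s \<in> {-2..-1}" "m \<ge> 2"
  shows "binom_coeff s m \<ge> 0"
proof -
  obtain k where m: "m = Suc (Suc k)"
    using assms(2) by (metis add_2_eq_Suc le_Suc_ex)
  have "pochhammer s m = s * (s + 1) * pochhammer (s + 1 + 1) k"
    by (simp add: m pochhammer_rec)
  also have "\<dots> \<ge> 0"
    using assms by (intro mult_nonneg_nonneg mult_nonpos_nonpos) (auto simp: pochhammer_prod intro!: prod_nonneg)
  finally show ?thesis
    by (simp add: binom_coeff_def)
qed

text \<open>The coefficient of z^n in the generating function, expanded as the geometric series with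
  terms x^k z^k (1 - z)^(-(\<alpha> k + \<beta>)).\<close>

definition ml_poly :: "real \<Rightarrow> real \<Rightarrow> nat \<Rightarrow> real \<Rightarrow> real" where
  "ml_poly \<alpha> \<beta> n x = (\<Sum>k\<le>n. binom_coeff (\<alpha> * real k + \<beta>) (n - k) * x ^ k)"

lemma ml_poly_0 [simp]: "ml_poly \<alpha> \<beta> 0 x = 1"
  by (simp add: ml_poly_def)

lemma ml_poly_pos:
  assumes "\<alpha> \<ge> 0" "\<beta> \<ge> 0" "x > 0"
  shows "ml_poly \<alpha> \<beta> n x > 0"
  unfolding ml_poly_def
\<comment> \<open>The leading coefficient is 1, whereas the constant one vanishes for \<beta> = 0
  and \<open>n\<close> > 0.\<close>
proof (rule sum_pos2[of _ n])
  show "0 \<le> binom_coeff (\<alpha> * real k + \<beta>) (n - k) * x ^ k" for k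
    using assms by (intro mult_nonneg_nonneg binom_coeff_nonneg) auto
qed (use assms in auto)

text \<open>Multiplying the generating function by (1 - z)^\<alpha> lowers each exponent parameter
  \<alpha> k + \<beta> by \<alpha>.\<close>

lemma ml_poly_convolution:
  "(\<Sum>j\<le>n. binom_coeff (-\<alpha>) j * ml_poly \<alpha> \<beta> (n - j) x) =
     (\<Sum>k\<le>n. binom_coeff (\<alpha> * real k + \<beta> - \<alpha>) (n - k) * x ^ k)"
proof -
  define g where "g = (\<lambda>j k. binom_coeff (-\<alpha>) j * (binom_coeff (\<alpha> * real k + \<beta>) (n - j - k) * x ^ k))"
  have "(\<Sum>j\<le>n. binom_coeff (-\<alpha>) j * ml_poly \<alpha> \<beta> (n - j) x) = (\<Sum>j\<le>n. \<Sum>k\<le>n-j. g j k)"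
    by (simp add: ml_poly_def g_def sum_distrib_left)
  also have "\<dots> = (\<Sum>k\<le>n. \<Sum>j\<le>n-k. g j k)"
    by (subst (1 2) sum.Sigma) (auto intro!: sum.reindex_bij_witness[of _ prod.swap prod.swap])
  also have "\<dots> = (\<Sum>k\<le>n. binom_coeff (\<alpha> * real k + \<beta> - \<alpha>) (n - k) * x ^ k)"
  proof (rule sum.cong)
    fix k
    have "binom_coeff (\<alpha> * real k + \<beta> - \<alpha>) (n - k) =
            (\<Sum>j\<le>n-k. binom_coeff (-\<alpha>) j * binom_coeff (\<alpha> * real k + \<beta>) (n - k - j))"
      using binom_coeff_convolution[of "-\<alpha>" "\<alpha> * real k + \<beta>" "n - k"] by simp
    thus "(\<Sum>j\<le>n-k. g j k) = binom_coeff (\<alpha> * real k + \<beta> - \<alpha>) (n - k) * x ^ k"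
      by (simp add: g_def sum_distrib_right mult.assoc add.commute)
  qed auto
  finally show ?thesis .
qed

lemma ml_poly_Suc:
  "ml_poly \<alpha> \<beta> (Suc n) x = (\<alpha> + x) * ml_poly \<alpha> \<beta> n x
     - ((\<Sum>i<n. binom_coeff (-\<alpha>) (Suc n - i) * ml_poly \<alpha> \<beta> i x) - binom_coeff (\<beta> - \<alpha>) (Suc n))"
proof -
  define p where "p = (\<lambda>n. ml_poly \<alpha> \<beta> n x)"
  define w where "w = binom_coeff (-\<alpha>)"
  have "(\<Sum>j\<le>Suc n. w j * p (Suc n - j)) = p (Suc n) - \<alpha> * p n + (\<Sum>j<n. w (Suc (Suc j)) * p (n - Suc j))"
    unfolding sum.atMost_shift sum.lessThan_Suc_shift
    by (simp add: w_def)
  also have "(\<Sum>j<n. w (Suc (Suc j)) * p (n - Suc j)) = (\<Sum>j<n. w (Suc n - (n - Suc j)) * p (n - Suc j))"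
    by (intro sum.cong refl) (auto simp: Suc_diff_Suc)
  also have "\<dots> = (\<Sum>i<n. w (Suc n - i) * p i)"
    by (rule sum.nat_diff_reindex[of "\<lambda>i. w (Suc n - i) * p i"])
  also have "(\<Sum>j\<le>Suc n. w j * p (Suc n - j)) =
               (\<Sum>k\<le>Suc n. binom_coeff (\<alpha> * real k + \<beta> - \<alpha>) (Suc n - k) * x ^ k)"
    unfolding p_def w_def by (rule ml_poly_convolution)
  \<comment> \<open>The term \<open>k = 0\<close> splits off; shifting \<open>k\<close> by one
    cancels the -\<alpha> and turns the rest into \<open>x * p n\<close>.\<close>
  also have "\<dots> = binom_coeff (\<beta> - \<alpha>) (Suc n) + x * p n"
    unfolding sum.atMost_Suc_shift
    by (simp add: p_def ml_poly_def sum_distrib_left algebra_simps)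
  finally show ?thesis
    by (simp add: p_def w_def algebra_simps)
qed

lemma cm_upto_ml_poly_quotient:
  assumes \<alpha>: "\<alpha> \<in> {1..2}" and \<beta>: "\<beta> \<in> {\<alpha> - 1..\<alpha>}"
  shows "i \<le> n \<Longrightarrow> cm_upto m (\<lambda>x. ml_poly \<alpha> \<beta> i x / ml_poly \<alpha> \<beta> n x)"
proof (induction n arbitrary: i)
  case 0
  thus ?case by (simp add: cm_upto_const)
next
  case (Suc n)
  let ?p = "ml_poly \<alpha> \<beta>"
  have pos: "?p n x > 0" if "x > 0" for n x
    using that \<alpha> \<beta> by (intro ml_poly_pos) auto
  \<comment> \<open>Since \<open>p\<^sub>0\<close> = 1, the inhomogeneous term is also a nonnegative
    weight times a quotient. In the sum \<open>Suc n - i\<close> is at least 2, as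
    \<open>binom_coeff_nonneg'\<close> requires.\<close>
  define S where "S = (\<lambda>x. (\<Sum>i<n. binom_coeff (-\<alpha>) (Suc n - i) * (?p i x / ?p n x))
                         + - binom_coeff (\<beta> - \<alpha>) (Suc n) * (?p 0 x / ?p n x))"
  have quotient: "?p (Suc n) x / ?p n x = \<alpha> + x - S x" if "x > 0" for x
    using pos[OF that, of n] unfolding ml_poly_Suc S_def
    by (simp add: diff_divide_distrib add_divide_distrib sum_divide_distrib)
  have "cm_upto m S"
    unfolding S_def using \<alpha> \<beta> binom_coeff_nonpos[of "\<beta> - \<alpha>" "Suc n"]
    by (intro cm_upto_add cm_upto_sum cm_upto_mult cm_upto_const Suc.IH binom_coeff_nonneg') auto
  moreover have "\<alpha> + x - S x > 0" if "x > 0" for x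
    unfolding quotient[OF that, symmetric] using pos[OF that] by simp
  ultimately have "cm_upto m (\<lambda>x. inverse (\<alpha> + x - S x))"
    by (rule cm_upto_inverse_minus)
  also have "?this \<longleftrightarrow> cm_upto m (\<lambda>x. ?p n x / ?p (Suc n) x)"
    by (intro cm_upto_cong) (simp flip: quotient)
  finally have step: "cm_upto m (\<lambda>x. ?p n x / ?p (Suc n) x)" .
  show ?case
  proof (cases "i = Suc n")
    case True
    have "cm_upto m (\<lambda>x. ?p i x / ?p (Suc n) x) \<longleftrightarrow> cm_upto m (\<lambda>_. 1)"
      by (intro cm_upto_cong) (use pos in \<open>auto simp: True less_imp_neq[symmetric]\<close>)
    thus ?thesis
      by (simp add: cm_upto_const)
  next
    case False
    hence "cm_upto m (\<lambda>x. ?p i x / ?p n x * (?p n x / ?p (Suc n) x))"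
      using Suc.prems by (intro cm_upto_mult Suc.IH step) auto
    also have "?this \<longleftrightarrow> ?thesis"
      by (intro cm_upto_cong) (use pos[of _ n] in \<open>auto simp: less_imp_neq[symmetric]\<close>)
    finally show ?thesis .
  qed
qed

section \<open>Passage to the limit\<close>

text \<open>By log-convexity, the slope of ln \<Gamma> over [y, y+t] is at most that over
  [y, y+t+1], hence at most that over [y+t, y+t+1], which the functional equation evaluates to ln
  (y+t).\<close>

lemma Gamma_add_le_powr:
  fixes y t :: real
  assumes "y > 0" "t \<ge> 0"
  shows "Gamma (y + t) \<le> Gamma y * (y + t) powr t"
proof (cases "t = 0")
  case False
  have pos: "Gamma y > 0" "Gamma (y + t) > 0"
    using assms by (simp_all add: Gamma_real_pos)
  have "((ln \<circ> Gamma) y - (ln \<circ> Gamma) (y + t)) / (y - (y + t)) \<le>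
          ((ln \<circ> Gamma) y - (ln \<circ> Gamma) (y + t + 1)) / (y - (y + t + 1))"
    using assms False by (intro convex_on_slope_le[OF log_convex_Gamma_real]) auto
  also have "\<dots> \<le> ((ln \<circ> Gamma) (y + t) - (ln \<circ> Gamma) (y + t + 1)) / ((y + t) - (y + t + 1))"
    using assms False by (intro convex_on_slope_le[OF log_convex_Gamma_real]) auto
  also have "\<dots> = ln (y + t)"
  proof -
    have "Gamma (y + t + 1) = (y + t) * Gamma (y + t)"
      using assms by (intro Gamma_plus1) (auto elim!: nonpos_Ints_cases)
    thus ?thesis
      using assms pos by (simp add: ln_mult del: Gamma_real_pos)
  qed
  finally have "ln (Gamma (y + t)) - ln (Gamma y) \<le> t * ln (y + t)"
    using assms False by (simp add: field_simps)
  hence "ln (Gamma (y + t)) \<le> ln (Gamma y * (y + t) powr t)"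
    using assms pos by (simp add: ln_mult ln_powr del: Gamma_real_pos)
  thus ?thesis
    using assms pos by (subst (asm) ln_le_cancel_iff) auto
qed (use assms in auto)

text \<open>For \<open>s\<close> = \<alpha> k + \<beta> this is the coefficient of x^k in
  n^(1-\<beta>) \<open>p\<^sub>n\<close>(n^(-\<alpha>) x). The value 0 beyond the degree lets the
  polynomial be treated as a power series.\<close>

definition ml_coeff :: "real \<Rightarrow> nat \<Rightarrow> nat \<Rightarrow> real" where
  "ml_coeff s k n = (if k \<le> n then binom_coeff s (n - k) * real n powr (1 - s) else 0)"

lemma ml_coeff_tendsto: "(\<lambda>n. ml_coeff s k (Suc n)) \<longlonglongrightarrow> rGamma s"
proof (rule LIMSEQ_offset[of _ k])
  \<comment> \<open>This factor converts \<open>rGamma_series s n\<close>, which has the rising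
    factorial of length n + 1 over n! n^s, into \<open>ml_coeff s k (Suc (n + k))\<close>.\<close>
  have "(\<lambda>n. real n powr s / real (Suc n) * real (Suc n + k) powr (1 - s)) \<longlonglongrightarrow> 1"
    by real_asymp
  hence "(\<lambda>n. rGamma_series s n * (real n powr s / real (Suc n) * real (Suc n + k) powr (1 - s)))
           \<longlonglongrightarrow> rGamma s * 1"
    by (intro tendsto_mult rGamma_series_LIMSEQ)
  moreover have "eventually (\<lambda>n. rGamma_series s n * (real n powr s / real (Suc n) * real (Suc n + k) powr (1 - s)) =
                   ml_coeff s k (Suc (n + k))) sequentially"
    using eventually_gt_at_top[of 0]
    by eventually_elim
       (simp add: rGamma_series_def ml_coeff_def binom_coeff_def powr_def Suc_diff_le mult.commute)
  ultimately show "(\<lambda>n. ml_coeff s k (Suc (n + k))) \<longlonglongrightarrow> rGamma s"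
    by (simp add: tendsto_cong)
qed

lemma ml_coeff_nonneg: "s \<ge> 0 \<Longrightarrow> ml_coeff s k n \<ge> 0"
  by (auto simp: ml_coeff_def binom_coeff_nonneg)

text \<open>A majorant free of \<open>n\<close>. The upper bound on \<open>s\<close> fits \<alpha> k
  + \<beta> with \<alpha> and \<beta> at most 2.\<close>

lemma ml_coeff_le:
  assumes s: "s \<ge> 1" "s \<le> 2 * real k + 2" and n: "n \<ge> 1"
  shows "ml_coeff s k n \<le> 4 powr (s - 1) * rGamma s"
proof (cases "k \<le> n")
  case True
  define m where "m = n - k"
  have "pochhammer s m = Gamma (real m + 1 + (s - 1)) * rGamma s"
    using s by (subst pochhammer_Gamma) (auto simp: rGamma_inverse_Gamma field_simps)
  also have "\<dots> \<le> Gamma (real m + 1) * (real m + 1 + (s - 1)) powr (s - 1) * rGamma s"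
    using s by (intro mult_right_mono Gamma_add_le_powr) (auto simp: rGamma_inverse_Gamma less_imp_le)
  also have "Gamma (real m + 1) = fact m"
    by (simp add: Gamma_fact add.commute)
  finally have "binom_coeff s m \<le> (real m + s) powr (s - 1) * rGamma s"
    by (simp add: binom_coeff_def field_simps)
  \<comment> \<open>The 4 comes from m + s \<le> (n - k) + (2 k + 2) = n + k + 2 \<le> 2 n + 2 \<le>
    4 n.\<close>
  also have "\<dots> \<le> (4 * real n) powr (s - 1) * rGamma s"
    using s n True
    by (intro mult_right_mono powr_mono2) (auto simp: m_def rGamma_inverse_Gamma less_imp_le)
  finally have "binom_coeff s m * real n powr (1 - s) \<le>
                  (4 * real n) powr (s - 1) * rGamma s * real n powr (1 - s)"
    by (rule mult_right_mono) simp
  also have "\<dots> = 4 powr (s - 1) * rGamma s * (real n powr (s - 1) * real n powr (1 - s))"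
    by (simp add: powr_mult)
  also have "real n powr (s - 1) * real n powr (1 - s) = 1"
    using n by (simp flip: powr_add)
  finally show ?thesis
    using True by (simp add: ml_coeff_def m_def)
qed (use s in \<open>auto simp: ml_coeff_def rGamma_inverse_Gamma less_imp_le\<close>)

lemma suminf_ml_coeff:
  assumes "n \<ge> 1"
  shows "(\<Sum>k. ml_coeff (\<alpha> * real k + \<beta>) k n * x ^ k) =
           real n powr (1 - \<beta>) * ml_poly \<alpha> \<beta> n (real n powr - \<alpha> * x)"
proof -
  have "(\<Sum>k. ml_coeff (\<alpha> * real k + \<beta>) k n * x ^ k) =
          (\<Sum>k\<le>n. ml_coeff (\<alpha> * real k + \<beta>) k n * x ^ k)"
    by (rule suminf_finite) (auto simp: ml_coeff_def)
  also have "\<dots> = real n powr (1 - \<beta>) * ml_poly \<alpha> \<beta> n (real n powr - \<alpha> * x)"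
    unfolding ml_poly_def sum_distrib_left
  proof (intro sum.cong refl)
    fix k assume k: "k \<in> {..n}"
    have "real n powr (1 - (\<alpha> * real k + \<beta>)) = real n powr (1 - \<beta>) * real n powr (- \<alpha> * real k)"
      by (simp flip: powr_add add: algebra_simps)
    also have "real n powr (- \<alpha> * real k) = (real n powr - \<alpha>) ^ k"
      using assms by (simp add: powr_power mult.commute)
    finally show "ml_coeff (\<alpha> * real k + \<beta>) k n * x ^ k = real n powr (1 - \<beta>) *
                    (binom_coeff (\<alpha> * real k + \<beta>) (n - k) * (real n powr - \<alpha> * x) ^ k)"
      using k by (simp add: ml_coeff_def power_mult_distrib mult_ac)
  qed
  finally show ?thesis .
qed

lemma C_tendsto_mittag_leffler:
  assumes \<alpha>: "\<alpha> \<in> {1..2}" and \<beta>: "\<beta> \<in> {\<alpha> - 1..\<alpha>}"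
  shows "C_tendsto m (\<lambda>n x. \<Sum>k. ml_coeff (\<alpha> * real k + \<beta>) k (Suc n) * x ^ k) (mittag_leffler \<alpha> \<beta>)"
proof -
  define b where "b = (\<lambda>k. 4 powr (\<alpha> * real k + \<beta> - 1) * rGamma (\<alpha> * real k + \<beta>))"
  have "C_tendsto m (\<lambda>n x. \<Sum>k. ml_coeff (\<alpha> * real k + \<beta>) k (Suc n) * x ^ k)
          (\<lambda>x. \<Sum>k. rGamma (\<alpha> * real k + \<beta>) * x ^ k)"
  proof (rule C_tendsto_power_series)
    show "summable (\<lambda>k. ml_coeff (\<alpha> * real k + \<beta>) k (Suc n) * y ^ k)" for n y
      by (rule summable_finite[of "{..Suc n}"]) (auto simp: ml_coeff_def)
    show "summable (\<lambda>k. rGamma (\<alpha> * real k + \<beta>) * y ^ k)" for y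
      using summable_mittag_leffler[of \<alpha> \<beta> y] \<alpha> by simp
    show "summable (\<lambda>k. b k * y ^ k)" for y
    proof -
      \<comment> \<open>The exponential factor of the majorant is absorbed into the argument of the
        Mittag-Leffler series, which converges everywhere.\<close>
      have "b k * y ^ k = 4 powr (\<beta> - 1) * (rGamma (\<alpha> * real k + \<beta>) * (4 powr \<alpha> * y) ^ k)" for k
      proof -
        have "4 powr (\<alpha> * real k + \<beta> - 1) = 4 powr (\<beta> - 1) * (4 powr (\<alpha> * real k) :: real)"
          by (simp flip: powr_add add: algebra_simps)
        also have "4 powr (\<alpha> * real k) = (4 powr \<alpha> :: real) ^ k"
          by (simp add: powr_power mult.commute)
        finally show ?thesis
          by (simp add: b_def power_mult_distrib mult_ac)
      qed
      moreover have "summable (\<lambda>k. rGamma (\<alpha> * real k + \<beta>) * (4 powr \<alpha> * y) ^ k)"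
        using summable_mittag_leffler[of \<alpha> \<beta> "4 powr \<alpha> * y"] \<alpha> by simp
      ultimately show ?thesis
        by (simp only: summable_mult)
    qed
    show "(\<lambda>n. ml_coeff (\<alpha> * real k + \<beta>) k (Suc n)) \<longlonglongrightarrow> rGamma (\<alpha> * real k + \<beta>)" for k
      by (rule ml_coeff_tendsto)
    show "\<bar>ml_coeff (\<alpha> * real k + \<beta>) k (Suc n)\<bar> \<le> b k" if "k \<ge> 1" for n k
    proof -
      \<comment> \<open>From \<open>k = 1\<close> on, \<alpha> k + \<beta> \<ge> \<alpha> \<ge> 1,
        because \<beta> \<ge> \<alpha> - 1 \<ge> 0.\<close>
      have "1 \<le> real k" "\<alpha> * 1 \<le> \<alpha> * real k" "\<alpha> * real k \<le> 2 * real k"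
        using that \<alpha> by (auto intro!: mult_left_mono mult_right_mono)
      hence "1 \<le> \<alpha> * real k + \<beta>" "\<alpha> * real k + \<beta> \<le> 2 * real k + 2"
        using \<alpha> \<beta> unfolding atLeastAtMost_iff by linarith+
      thus ?thesis
        unfolding b_def using ml_coeff_nonneg[of "\<alpha> * real k + \<beta>" k "Suc n"]
          ml_coeff_le[of "\<alpha> * real k + \<beta>" k "Suc n"] by simp
    qed
  qed
  thus ?thesis
    by (simp add: mittag_leffler_def[abs_def])
qed

section \<open>Positivity of the limit and conclusion\<close>

lemma mittag_leffler_pos:
  fixes x :: real
  assumes "\<alpha> > 0" "\<beta> \<ge> 0" "x > 0"
  shows "mittag_leffler \<alpha> \<beta> x > 0"
proof -
  have "rGamma s \<ge> 0" if "s \<ge> 0" for s :: real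
    using that by (cases "s = 0") (auto simp: rGamma_inverse_Gamma less_imp_le)
  \<comment> \<open>The term \<open>k = 1\<close> provides strictness, since the one for
    \<open>k = 0\<close> vanishes when \<beta> = 0.\<close>
  moreover have "rGamma (\<alpha> * real 1 + \<beta>) > 0"
    using assms by (simp add: rGamma_inverse_Gamma)
  ultimately show ?thesis
    unfolding mittag_leffler_def
    using summable_mittag_leffler[OF assms(1), of \<beta> x] assms by (intro suminf_pos2[of _ 1]) auto
qed

theorem proposition3:
  fixes \<alpha> \<beta> :: real
  assumes "\<alpha> \<in> {1..2}" and "\<beta> \<in> {\<alpha> - 1..\<alpha>}"
  shows "completely_monotone (\<lambda>x::real. 1 / mittag_leffler \<alpha> \<beta> x)"
proof (rule completely_monotoneI)
  have ml_pos: "mittag_leffler \<alpha> \<beta> x > 0" if "x > 0" for x :: real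
    using assms that by (intro mittag_leffler_pos) auto
  thus "1 / mittag_leffler \<alpha> \<beta> x > 0" if "x > 0" for x :: real
    using that by simp
  fix m
  \<comment> \<open>The index starts at \<open>Suc n\<close> because \<open>0 powr a\<close> is 0,
    so index 0 would give the zero function, which has no usable reciprocal.\<close>
  define F where "F = (\<lambda>n x. \<Sum>k. ml_coeff (\<alpha> * real k + \<beta>) k (Suc n) * x ^ k)"
  have F_eq: "F n x = real (Suc n) powr (1 - \<beta>) * ml_poly \<alpha> \<beta> (Suc n) (real (Suc n) powr - \<alpha> * x)" for n x
    unfolding F_def by (rule suminf_ml_coeff) simp
  have "F n x \<noteq> 0" if "x > 0" for n x
  proof -
    have "ml_poly \<alpha> \<beta> (Suc n) (real (Suc n) powr - \<alpha> * x) > 0"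
      using assms that by (intro ml_poly_pos) auto
    thus ?thesis
      by (simp add: F_eq)
  qed
  moreover have "C_tendsto m F (mittag_leffler \<alpha> \<beta>)"
    unfolding F_def using assms by (rule C_tendsto_mittag_leffler)
  ultimately have "C_tendsto m (\<lambda>n x. inverse (F n x)) (\<lambda>x. inverse (mittag_leffler \<alpha> \<beta> x))"
    using ml_pos by (intro C_tendsto_inverse) (auto simp: less_imp_neq[symmetric])
  moreover have "cm_upto m (\<lambda>x. inverse (F n x))" for n
  proof -
    let ?c = "real (Suc n) powr - \<alpha>" and ?p = "ml_poly \<alpha> \<beta>"
    \<comment> \<open>As \<open>p\<^sub>0\<close> = 1, the quotient with \<open>i = 0\<close> is the
      reciprocal of the rescaled polynomial.\<close>
    have "cm_upto m (\<lambda>x. ?p 0 (?c * x) / ?p (Suc n) (?c * x))"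
      by (rule cm_upto_scale[OF _ cm_upto_ml_poly_quotient[OF assms]]) auto
    hence "cm_upto m (\<lambda>x. inverse (real (Suc n) powr (1 - \<beta>)) * (?p 0 (?c * x) / ?p (Suc n) (?c * x)))"
      by (intro cm_upto_mult cm_upto_const) auto
    thus ?thesis
      by (simp add: F_eq divide_inverse)
  qed
  ultimately show "cm_upto m (\<lambda>x. 1 / mittag_leffler \<alpha> \<beta> x)"
    unfolding inverse_eq_divide[symmetric] by (rule cm_upto_C_tendsto)
qed

end
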